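(* Let $A$ be a complex $m\times n$ matrix, $\mathcal{P}$ a partition of $[m]$, and $\mathcal{Q}$ a partition of $[n]$. Then $\sigma_1(A)\geq\sigma_1(A|\mathcal{P}\times\mathcal{Q})$. Moreover, if $A$ is nonnegative, $AA^{\ast}$ and $A^{\ast}A$ are irreducible, and $\mathcal{P}\times\mathcal{Q}$ is equitable for $A$, then $\sigma_1(A)=\sigma_1(A|\mathcal{P}\times\mathcal{Q})$.
   Context: $[n]=\{1,\ldots,n\}$; partitions consist of nonempty sets. $\sigma_1(M)$ denotes the largest singular value of $M$, and $A^{\ast}$ is the Hermitian transpose of $A$. For a matrix $A=\{a_{ij}\}$ of size $m\times n$ and $I\subset[m]$, $J\subset[n]$, $A[I,J]$ is the submatrix of all $a_{ij}$ with $i\in I$, $j\in J$. A matrix is called regular if all its row sums are equal and all its column sums are equal. For partitions $\mathcal{P}=\{P_1,\ldots,P_k\}$ of $[m]$ and $\mathcal{Q}=\{Q_1,\ldots,Q_l\}$ of $[n]$, $\mathcal{P}\times\mathcal{Q}=\{P_i\times Q_j: i\in[k], j\in[l]\}$ is called equitable for $A$ if $A[P_p,Q_q]$ is regular for all $p\in[k]$, $q\in[l]$. $A|\mathcal{P}\times\mathcal{Q}$ denotes the $k\times l$ (quotient) matrix $\{b_{pq}\}$ with $$b_{pq}=\frac{1}{\sqrt{|P_p||Q_q|}}\sum_{i\in P_p,\,j\in Q_q}a_{ij}.$$ *)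

theory Defs
  imports
    "Jordan_Normal_Form.Schur_Decomposition"
    "Jordan_Normal_Form.DL_Submatrix"
    "HOL-Library.Disjoint_Sets"
    "HOL-Library.Nonpos_Ints"
    "HOL-Combinatorics.Permutations"
begin

text \<open>
  Row and column indices run over \<open>{0..<m}\<close> and \<open>{0..<n}\<close>.
\<close>

text \<open>
  The square roots of the eigenvalues of \<open>M\<^sup>* M\<close>. For a matrix with more columns than rows this
  may list the value 0 in addition to the \<open>min m n\<close> singular values; the maximum is unaffected.
  \<open>Max\<close> is meaningful when \<open>M\<close> has at least one row and one column.
\<close>

definition singular_values :: "complex mat \<Rightarrow> real set" where
  "singular_values M =
     {s. 0 \<le> s \<and> eigenvalue (mat_adjoint M * M) (complex_of_real (s\<^sup>2))}"

definition sigma1 :: "complex mat \<Rightarrow> real" where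
  "sigma1 M = Max (singular_values M)"

definition nonneg_complex_mat :: "complex mat \<Rightarrow> bool" where
  "nonneg_complex_mat A \<longleftrightarrow> (\<forall>i<dim_row A. \<forall>j<dim_col A. A $$ (i,j) \<in> \<real>\<^sub>\<ge>\<^sub>0)"

text \<open>
  Reducible: some simultaneous permutation of rows and columns gives a block upper triangular matrix
  with square diagonal blocks of sizes \<open>r\<close> and \<open>n - r\<close>, both positive. Every 1 by 1 matrix, the
  zero matrix included, is therefore irreducible.
\<close>

definition reducible_mat :: "complex mat \<Rightarrow> bool" where
  "reducible_mat A \<longleftrightarrow>
     (\<exists>p r. p permutes {0..<dim_row A} \<and> 0 < r \<and> r < dim_row A \<and>
        (\<forall>i\<in>{r..<dim_row A}. \<forall>j\<in>{0..<r}. A $$ (p i, p j) = 0))"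

definition irreducible_mat :: "complex mat \<Rightarrow> bool" where
  "irreducible_mat A \<longleftrightarrow> square_mat A \<and> \<not> reducible_mat A"

definition regular_mat :: "complex mat \<Rightarrow> bool" where
  "regular_mat A \<longleftrightarrow>
     (\<forall>i<dim_row A. \<forall>i'<dim_row A. (\<Sum>j<dim_col A. A $$ (i,j)) = (\<Sum>j<dim_col A. A $$ (i',j))) \<and>
     (\<forall>j<dim_col A. \<forall>j'<dim_col A. (\<Sum>i<dim_row A. A $$ (i,j)) = (\<Sum>i<dim_row A. A $$ (i,j')))"

text \<open>
  A partition is given by a list of its parts without repetition, so that the rows and columns of
  the quotient matrix are numbered.
\<close>

definition enum_partition :: "'a set \<Rightarrow> 'a set list \<Rightarrow> bool" where
  "enum_partition X Ps \<longleftrightarrow> distinct Ps \<and> partition_on X (set Ps)"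

definition equitable :: "complex mat \<Rightarrow> nat set list \<Rightarrow> nat set list \<Rightarrow> bool" where
  "equitable A Ps Qs \<longleftrightarrow>
     (\<forall>p<length Ps. \<forall>q<length Qs. regular_mat (submatrix A (Ps ! p) (Qs ! q)))"

definition quotient_mat :: "complex mat \<Rightarrow> nat set list \<Rightarrow> nat set list \<Rightarrow> complex mat" where
  "quotient_mat A Ps Qs =
     mat (length Ps) (length Qs) (\<lambda>(p,q).
       complex_of_real (1 / sqrt (real (card (Ps ! p)) * real (card (Qs ! q)))) *
       (\<Sum>i\<in>Ps ! p. \<Sum>j\<in>Qs ! q. A $$ (i,j)))"

end

theory Submission
  imports Defs "Jordan_Normal_Form.Spectral_Radius"
begin

text \<open>
  Attach to a partition of an index set the matrix whose columns are the normalised indicator vectors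
  of the parts (\<open>part_mat\<close>). Its columns are orthonormal, and if \<open>U\<close> and \<open>V\<close> are the matrices of the
  row and of the column partition, the quotient matrix is \<open>B = U\<^sup>* A V\<close>. Since \<open>V\<close> is an isometry
  and \<open>U\<^sup>*\<close> a contraction, \<open>B\<close> cannot stretch a vector by more than \<open>\<sigma>\<^sub>1(A)\<close>, which
  gives the inequality (\<open>sigma1_quotient_mat_le\<close>).

  If the partition is equitable, the row sums within the blocks say that \<open>A V = U B\<close> and the column
  sums say that \<open>A\<^sup>* U = V B\<^sup>*\<close>. Taking adjoints, \<open>B\<^sup>* B V\<^sup>* = V\<^sup>* A\<^sup>* A\<close>, so \<open>V\<^sup>*\<close> maps
  eigenvectors of \<open>A\<^sup>* A\<close> to eigenvectors of \<open>B\<^sup>* B\<close>, provided that it does not annihilate them. For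
  nonnegative \<open>A\<close> the largest eigenvalue \<open>\<sigma>\<^sub>1(A)\<^sup>2\<close> has an eigenvector with nonnegative entries
  (\<open>nonneg_sigma1_eigenvector\<close>); the entries of its image are positive multiples of its sums over the
  parts, and these do not all vanish. So \<open>\<sigma>\<^sub>1(A)\<close> is a singular value of \<open>B\<close>, whence the reverse
  inequality (\<open>sigma1_equitable_le\<close>).

  Both halves rest on two facts about \<open>\<sigma>\<^sub>1\<close>: it is the best constant in
  \<open>|M x| \<le> \<sigma>\<^sub>1(M) |x|\<close> (\<open>sqnorm_mult_le_sigma1\<close>), and every vector that attains the bound is an
  eigenvector of \<open>M\<^sup>* M\<close> (\<open>sigma1_maximiser_is_eigenvector\<close>). The source of both is an estimate:
  with \<open>\<mu> \<ge> 0\<close> any constant such that \<open>|M x|\<^sup>2 \<le> \<mu> |x|\<^sup>2\<close> for all \<open>x\<close>, the residual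
  \<open>|\<mu> x - M\<^sup>* M x|\<^sup>2\<close> is at most a constant times \<open>\<mu> |x|\<^sup>2 - |M x|\<^sup>2\<close> (\<open>sqnorm_defect_le\<close>). If the
  optimal \<open>\<mu>\<close> were not an eigenvalue of \<open>M\<^sup>* M\<close>, a multiple of the residual would bound \<open>|x|\<^sup>2\<close>, and
  \<open>\<mu>\<close> could be lowered.
\<close>

section \<open>Adjoints and the Euclidean norm\<close>

definition sqnorm :: "complex vec \<Rightarrow> real" where
  "sqnorm v = (\<Sum>i = 0..<dim_vec v. (cmod (v $ i))\<^sup>2)"

lemma mat_adjoint_dim [simp]:
  "dim_row (mat_adjoint A) = dim_col A" "dim_col (mat_adjoint A) = dim_row A"
  unfolding mat_adjoint_def by auto

lemma mat_adjoint_carrier [simp]: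
  "A \<in> carrier_mat m n \<Longrightarrow> mat_adjoint A \<in> carrier_mat n m"
  unfolding mat_adjoint_def by auto

lemma mat_adjoint_mult_vec_carrier [simp]:
  "A \<in> carrier_mat m n \<Longrightarrow> mat_adjoint A *\<^sub>v x \<in> carrier_vec n"
  by (auto intro!: carrier_vecI)

lemma gram_carrier [simp]:
  "A \<in> carrier_mat m n \<Longrightarrow> mat_adjoint A * A \<in> carrier_mat n n"
  by (rule mult_carrier_mat[OF mat_adjoint_carrier])

lemma gram_mult_vec_carrier [simp]:
  "A \<in> carrier_mat m n \<Longrightarrow> mat_adjoint A * A *\<^sub>v x \<in> carrier_vec n"
  by (auto intro!: carrier_vecI)

lemma mat_adjoint_index [simp]:
  "i < dim_col A \<Longrightarrow> j < dim_row A \<Longrightarrow> mat_adjoint A $$ (i, j) = conjugate (A $$ (j, i))"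
  unfolding mat_adjoint_def by (simp add: mat_of_rows_index)

lemma mat_adjoint_adjoint [simp]: "mat_adjoint (mat_adjoint A) = A"
  by (rule eq_matI) auto

lemma mat_adjoint_mult:
  fixes A B :: "complex mat"
  assumes "A \<in> carrier_mat m n" "B \<in> carrier_mat n k"
  shows "mat_adjoint (A * B) = mat_adjoint B * mat_adjoint A"
  using assms by (intro eq_matI) (auto simp: scalar_prod_def mult.commute)

lemma sqnorm_nonneg: "0 \<le> sqnorm v"
  unfolding sqnorm_def by (intro sum_nonneg) auto

lemma sqnorm_cscalar: "v \<bullet>c v = complex_of_real (sqnorm v)"
  unfolding sqnorm_def scalar_prod_def by (simp add: complex_norm_square del: of_real_power)

lemma sqnorm_eq_0: "sqnorm v = 0 \<longleftrightarrow> v = 0\<^sub>v (dim_vec v)"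
proof -
  have "sqnorm v = 0 \<longleftrightarrow> v \<bullet>c v = 0" by (simp add: sqnorm_cscalar)
  then show ?thesis by (simp add: conjugate_square_eq_0_vec[OF carrier_vec_dim_vec])
qed

lemma sqnorm_smult: "sqnorm (c \<cdot>\<^sub>v v) = (cmod c)\<^sup>2 * sqnorm v"
  unfolding sqnorm_def by (simp add: norm_mult power_mult_distrib sum_distrib_left)

lemma cscalar_sums:
  assumes "x \<in> carrier_vec n" "y \<in> carrier_vec n"
  shows "x \<bullet>c y = (\<Sum>i = 0..<n. x $ i * cnj (y $ i))"
  using assms unfolding scalar_prod_def by auto

lemma sqnorm_minus_smult:
  assumes x: "x \<in> carrier_vec n" and y: "y \<in> carrier_vec n"
  shows "sqnorm (x - complex_of_real t \<cdot>\<^sub>v y) = sqnorm x - 2 * t * Re (x \<bullet>c y) + t\<^sup>2 * sqnorm y"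
proof -
  have "(cmod (a - complex_of_real t * b))\<^sup>2 =
      (cmod a)\<^sup>2 - 2 * t * Re (a * cnj b) + t\<^sup>2 * (cmod b)\<^sup>2" for a b :: complex
    by (simp only: cmod_power2) (simp add: power2_eq_square algebra_simps)
  then show ?thesis
    using x y unfolding cscalar_sums[OF x y] sqnorm_def Re_sum
    by (simp add: sum.distrib sum_subtractf sum_distrib_left del: times_complex.sel)
qed

lemma cscalar_mult_mat_left:
  fixes M :: "complex mat"
  assumes M: "M \<in> carrier_mat m n" and x: "x \<in> carrier_vec n" and y: "y \<in> carrier_vec m"
  shows "(M *\<^sub>v x) \<bullet>c y = x \<bullet>c (mat_adjoint M *\<^sub>v y)"
proof -
  have "(M *\<^sub>v x) \<bullet>c y = (\<Sum>i = 0..<m. \<Sum>j = 0..<n. M $$ (i, j) * x $ j * cnj (y $ i))"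
    using assms by (subst cscalar_sums[of _ m]) (auto simp: scalar_prod_def sum_distrib_right)
  also have "\<dots> = (\<Sum>j = 0..<n. \<Sum>i = 0..<m. M $$ (i, j) * x $ j * cnj (y $ i))"
    by (rule sum.swap)
  also have "\<dots> = x \<bullet>c (mat_adjoint M *\<^sub>v y)"
    using assms
    by (subst cscalar_sums[of _ n]) (auto simp: scalar_prod_def sum_distrib_left mult_ac)
  finally show ?thesis .
qed

lemma cscalar_mult_mat_right:
  fixes M :: "complex mat"
  assumes M: "M \<in> carrier_mat m n" and x: "x \<in> carrier_vec n" and y: "y \<in> carrier_vec m"
  shows "y \<bullet>c (M *\<^sub>v x) = (mat_adjoint M *\<^sub>v y) \<bullet>c x"
  using cscalar_mult_mat_left[of "mat_adjoint M" n m y x] assms by simp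

text \<open>
  A crude bound suffices, since only the existence of a constant matters: each entry of \<open>x\<close> has modulus
  at most \<open>|x|\<close>.
\<close>

lemma sqnorm_mult_le:
  assumes M: "M \<in> carrier_mat m n"
  obtains C where "0 < C" "\<And>x. x \<in> carrier_vec n \<Longrightarrow> sqnorm (M *\<^sub>v x) \<le> C * sqnorm x"
proof
  let ?r = "\<lambda>i. \<Sum>j = 0..<n. cmod (M $$ (i, j))"
  let ?C = "1 + (\<Sum>i = 0..<m. (?r i)\<^sup>2)"
  show "0 < ?C" by (smt (verit) sum_nonneg zero_le_power2)
  fix x :: "complex vec" assume x: "x \<in> carrier_vec n"
  have xj: "cmod (x $ j) \<le> sqrt (sqnorm x)" if "j < n" for j
  proof -
    have "(cmod (x $ j))\<^sup>2 \<le> sqnorm x"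
      unfolding sqnorm_def using x that by (intro member_le_sum) auto
    then show ?thesis by (simp add: real_le_rsqrt)
  qed
  have "cmod ((M *\<^sub>v x) $ i) \<le> ?r i * sqrt (sqnorm x)" if "i < m" for i
  proof -
    have "cmod ((M *\<^sub>v x) $ i) \<le> (\<Sum>j = 0..<n. cmod (M $$ (i, j)) * cmod (x $ j))"
      using M x that by (auto simp: scalar_prod_def norm_mult intro: order_trans[OF norm_sum])
    also have "\<dots> \<le> (\<Sum>j = 0..<n. cmod (M $$ (i, j)) * sqrt (sqnorm x))"
      by (intro sum_mono mult_left_mono) (auto intro: xj)
    finally show ?thesis by (simp add: sum_distrib_right)
  qed
  then have "(cmod ((M *\<^sub>v x) $ i))\<^sup>2 \<le> (?r i)\<^sup>2 * sqnorm x" if "i < m" for i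
    using power_mono[of "cmod ((M *\<^sub>v x) $ i)" "?r i * sqrt (sqnorm x)" 2] that
    by (simp add: power_mult_distrib sqnorm_nonneg)
  then have "(\<Sum>i = 0..<m. (cmod ((M *\<^sub>v x) $ i))\<^sup>2) \<le> (\<Sum>i = 0..<m. (?r i)\<^sup>2 * sqnorm x)"
    by (intro sum_mono) simp
  then have "sqnorm (M *\<^sub>v x) \<le> (\<Sum>i = 0..<m. (?r i)\<^sup>2 * sqnorm x)"
    unfolding sqnorm_def[of "M *\<^sub>v x"] using M by simp
  also have "\<dots> \<le> ?C * sqnorm x"
    using sqnorm_nonneg[of x] by (simp add: sum_distrib_right distrib_right)
  finally show "sqnorm (M *\<^sub>v x) \<le> ?C * sqnorm x" .
qed

section \<open>The largest singular value\<close>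

text \<open>
  The form \<open>d v = \<mu> |v|\<^sup>2 - |M v|\<^sup>2\<close> is positive semidefinite and half its gradient at \<open>x\<close> is
  \<open>y = \<mu> x - M\<^sup>* M x\<close>. A step of length \<open>t\<close> against the gradient lowers \<open>d\<close> by
  \<open>2 t |y|\<^sup>2 - t\<^sup>2 d y\<close>, and it cannot fall below zero; so a small \<open>d x\<close> forces a small gradient.
\<close>

lemma sqnorm_defect_le:
  fixes M :: "complex mat"
  assumes M: "M \<in> carrier_mat m n" and mu: "0 \<le> \<mu>"
    and bound: "\<And>x. x \<in> carrier_vec n \<Longrightarrow> sqnorm (M *\<^sub>v x) \<le> \<mu> * sqnorm x"
    and x: "x \<in> carrier_vec n"
  shows "sqnorm (complex_of_real \<mu> \<cdot>\<^sub>v x - (mat_adjoint M * M) *\<^sub>v x)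
    \<le> (\<mu> + 1) * (\<mu> * sqnorm x - sqnorm (M *\<^sub>v x))"
proof -
  define y where "y = complex_of_real \<mu> \<cdot>\<^sub>v x - (mat_adjoint M * M) *\<^sub>v x"
  define d where "d v = \<mu> * sqnorm v - sqnorm (M *\<^sub>v v)" for v
  \<comment> \<open>The best step would be \<open>1 / \<mu>\<close>; adding 1 covers \<open>\<mu> = 0\<close>.\<close>
  define t where "t = 1 / (\<mu> + 1)"
  have adj: "mat_adjoint M \<in> carrier_mat n m" using M by simp
  have Gx: "(mat_adjoint M * M) *\<^sub>v x = mat_adjoint M *\<^sub>v (M *\<^sub>v x)"
    using assoc_mult_mat_vec[OF adj M x] .
  have G: "mat_adjoint M *\<^sub>v (M *\<^sub>v x) \<in> carrier_vec n" using adj M x by auto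
  have y: "y \<in> carrier_vec n" unfolding y_def Gx using x G by auto
  have My: "M *\<^sub>v y \<in> carrier_vec m" and Mx: "M *\<^sub>v x \<in> carrier_vec m" using M x y by auto
  have "complex_of_real \<mu> * (x \<bullet>c y) - (M *\<^sub>v x) \<bullet>c (M *\<^sub>v y) = y \<bullet>c y"
  proof -
    have "(M *\<^sub>v x) \<bullet>c (M *\<^sub>v y) = (mat_adjoint M *\<^sub>v (M *\<^sub>v x)) \<bullet>c y"
      by (rule cscalar_mult_mat_right[OF M y Mx])
    moreover have "y \<bullet>c y =
        complex_of_real \<mu> * (x \<bullet>c y) - (mat_adjoint M *\<^sub>v (M *\<^sub>v x)) \<bullet>c y"
      using x y G
      by (subst (1) y_def, subst Gx, subst minus_scalar_prod_distrib[of _ n]) auto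
    ultimately show ?thesis by simp
  qed
  then have key: "\<mu> * Re (x \<bullet>c y) - Re ((M *\<^sub>v x) \<bullet>c (M *\<^sub>v y)) = sqnorm y"
    unfolding sqnorm_cscalar by (auto dest: arg_cong[of _ _ Re])
  have "M *\<^sub>v (x - complex_of_real t \<cdot>\<^sub>v y) = M *\<^sub>v x - complex_of_real t \<cdot>\<^sub>v (M *\<^sub>v y)"
    using M x y by (simp add: mult_minus_distrib_mat_vec mult_mat_vec)
  then have "d (x - complex_of_real t \<cdot>\<^sub>v y) = d x - 2 * t * sqnorm y + t\<^sup>2 * d y"
    unfolding d_def
    using arg_cong[OF key, of "\<lambda>r. 2 * t * r"]
    by (simp add: sqnorm_minus_smult[OF x y] sqnorm_minus_smult[OF Mx My] algebra_simps)
  moreover have "0 \<le> d (x - complex_of_real t \<cdot>\<^sub>v y)"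
    unfolding d_def using bound[of "x - complex_of_real t \<cdot>\<^sub>v y"] x y by simp
  moreover have "d y \<le> (\<mu> + 1) * sqnorm y"
    unfolding d_def using sqnorm_nonneg[of y] sqnorm_nonneg[of "M *\<^sub>v y"]
    by (simp add: algebra_simps)
  then have "t\<^sup>2 * d y \<le> t\<^sup>2 * ((\<mu> + 1) * sqnorm y)"
    by (rule mult_left_mono) simp
  moreover have "t\<^sup>2 * ((\<mu> + 1) * sqnorm y) = t * sqnorm y"
  proof -
    have "t * (\<mu> + 1) = 1" unfolding t_def using mu by simp
    then show ?thesis by (simp add: power2_eq_square flip: mult.assoc)
  qed
  ultimately have "t * sqnorm y \<le> d x" by linarith
  then show ?thesis
    unfolding t_def d_def y_def[symmetric] using mu by (simp add: field_simps)
qed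

text \<open>
  The witness is the least constant \<open>\<mu>\<close> with \<open>|M x|\<^sup>2 \<le> \<mu> |x|\<^sup>2\<close>. Were \<open>M\<^sup>* M - \<mu> 1\<close> invertible, then
  \<open>|x|\<^sup>2\<close> would be bounded by a multiple of \<open>|\<mu> x - M\<^sup>* M x|\<^sup>2\<close>, hence by a multiple of
  \<open>\<mu> |x|\<^sup>2 - |M x|\<^sup>2\<close>, and a smaller constant would do.
\<close>

lemma ex_largest_eigenvalue:
  fixes M :: "complex mat"
  assumes M: "M \<in> carrier_mat m n" and n: "1 \<le> n"
  obtains \<mu> where "0 \<le> \<mu>" "eigenvalue (mat_adjoint M * M) (complex_of_real \<mu>)"
    "\<And>x. x \<in> carrier_vec n \<Longrightarrow> sqnorm (M *\<^sub>v x) \<le> \<mu> * sqnorm x"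
proof -
  define S where "S = {C. \<forall>x\<in>carrier_vec n. sqnorm (M *\<^sub>v x) \<le> C * sqnorm x}"
  define \<mu> where "\<mu> = Inf S"
  let ?G = "mat_adjoint M * M"
  have G: "?G \<in> carrier_mat n n" using M by simp
  \<comment> \<open>This needs a nonzero vector: for \<open>n = 0\<close> every real lies in \<open>S\<close> and the infimum is meaningless.\<close>
  have pos: "0 \<le> C" if "C \<in> S" for C
  proof -
    define e :: "complex vec" where "e = unit_vec n 0"
    have e: "e \<in> carrier_vec n" "e \<noteq> 0\<^sub>v n" unfolding e_def using n by auto
    then have "0 < sqnorm e" using sqnorm_eq_0[of e] sqnorm_nonneg[of e] by auto
    moreover have "0 \<le> C * sqnorm e"
      using that e sqnorm_nonneg[of "M *\<^sub>v e"] unfolding S_def by fastforce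
    ultimately show ?thesis by (simp add: zero_le_mult_iff)
  qed
  obtain C\<^sub>0 where "\<And>x. x \<in> carrier_vec n \<Longrightarrow> sqnorm (M *\<^sub>v x) \<le> C\<^sub>0 * sqnorm x"
    using sqnorm_mult_le[OF M] by metis
  then have "C\<^sub>0 \<in> S" unfolding S_def by simp
  then have ne: "S \<noteq> {}" by auto
  have bdd: "bdd_below S" using pos by (rule bdd_belowI)
  have mu: "0 \<le> \<mu>" unfolding \<mu>_def using ne pos by (rule cInf_greatest)
  have bound: "sqnorm (M *\<^sub>v x) \<le> \<mu> * sqnorm x" if x: "x \<in> carrier_vec n" for x
  proof (cases "sqnorm x = 0")
    case True
    then show ?thesis using \<open>C\<^sub>0 \<in> S\<close> x unfolding S_def by auto
  next
    case False
    then have s: "0 < sqnorm x" using sqnorm_nonneg[of x] by simp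
    have "sqnorm (M *\<^sub>v x) / sqnorm x \<le> \<mu>"
      unfolding \<mu>_def using ne
    proof (rule cInf_greatest)
      fix C assume "C \<in> S"
      then show "sqnorm (M *\<^sub>v x) / sqnorm x \<le> C"
        using x s unfolding S_def by (simp add: field_simps)
    qed
    then show ?thesis using s by (simp add: field_simps)
  qed
  have "eigenvalue ?G (complex_of_real \<mu>)"
  proof (rule ccontr)
    assume "\<not> ?thesis"
    define K where "K = char_matrix ?G (complex_of_real \<mu>)"
    have K: "K \<in> carrier_mat n n" unfolding K_def using G by simp
    have "det K \<noteq> 0"
      using \<open>\<not> eigenvalue _ _\<close> unfolding eigenvalue_det[OF G] K_def .
    from det_non_zero_imp_unit[OF K this, unfolded Units_def, of "()"]
    obtain Q where Q: "Q \<in> carrier_mat n n" and QK: "Q * K = 1\<^sub>m n"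
      by (auto simp: ring_mat_def)
    obtain C where C: "0 < C" "\<And>x. x \<in> carrier_vec n \<Longrightarrow> sqnorm (Q *\<^sub>v x) \<le> C * sqnorm x"
      using sqnorm_mult_le[OF Q] by metis
    define \<epsilon> where "\<epsilon> = 1 / (C * (\<mu> + 1))"
    have eps: "0 < \<epsilon>" unfolding \<epsilon>_def using C mu by simp
    have "\<mu> - \<epsilon> \<in> S" unfolding S_def
    proof (intro CollectI ballI)
      fix x :: "complex vec" assume x: "x \<in> carrier_vec n"
      have "K *\<^sub>v x = (- 1) \<cdot>\<^sub>v (complex_of_real \<mu> \<cdot>\<^sub>v x - ?G *\<^sub>v x)"
        unfolding K_def char_matrix_def using G x M
        by (intro eq_vecI) (auto simp: add_mult_distrib_mat_vec[OF G])
      then have Kx: "sqnorm (K *\<^sub>v x) = sqnorm (complex_of_real \<mu> \<cdot>\<^sub>v x - ?G *\<^sub>v x)"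
        by (simp add: sqnorm_smult)
      have "x = Q *\<^sub>v (K *\<^sub>v x)" using assoc_mult_mat_vec[OF Q K x] QK x by simp
      then have "sqnorm x \<le> C * sqnorm (K *\<^sub>v x)"
        using C(2)[of "K *\<^sub>v x"] K x by simp
      also have "\<dots> \<le> C * ((\<mu> + 1) * (\<mu> * sqnorm x - sqnorm (M *\<^sub>v x)))"
        unfolding Kx using C(1) sqnorm_defect_le[OF M mu bound x] by simp
      finally have "\<epsilon> * sqnorm x \<le> \<mu> * sqnorm x - sqnorm (M *\<^sub>v x)"
        unfolding \<epsilon>_def using C(1) mu by (simp add: pos_divide_le_eq mult_ac)
      then show "sqnorm (M *\<^sub>v x) \<le> (\<mu> - \<epsilon>) * sqnorm x"
        by (simp add: left_diff_distrib)
    qed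
    then have "\<mu> \<le> \<mu> - \<epsilon>" unfolding \<mu>_def using bdd by (rule cInf_lower)
    with eps show False by simp
  qed
  with mu bound that show thesis by blast
qed

lemma sqnorm_mult_eigenvector:
  fixes M :: "complex mat"
  assumes M: "M \<in> carrier_mat m n" and x: "x \<in> carrier_vec n"
    and ev: "(mat_adjoint M * M) *\<^sub>v x = complex_of_real \<mu> \<cdot>\<^sub>v x"
  shows "sqnorm (M *\<^sub>v x) = \<mu> * sqnorm x"
proof -
  have "(M *\<^sub>v x) \<bullet>c (M *\<^sub>v x) = (mat_adjoint M *\<^sub>v (M *\<^sub>v x)) \<bullet>c x"
    using M x by (intro cscalar_mult_mat_right) auto
  also have "mat_adjoint M *\<^sub>v (M *\<^sub>v x) = complex_of_real \<mu> \<cdot>\<^sub>v x"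
    using assoc_mult_mat_vec[of "mat_adjoint M" n m M n x] M x ev by simp
  finally show ?thesis
    using x by (simp add: sqnorm_cscalar flip: of_real_mult)
qed

lemma sqrt_in_singular_values:
  assumes "0 \<le> \<mu>" "eigenvalue (mat_adjoint M * M) (complex_of_real \<mu>)"
  shows "sqrt \<mu> \<in> singular_values M"
  using assms unfolding singular_values_def by (simp del: of_real_power)

lemma finite_singular_values:
  assumes M: "M \<in> carrier_mat m n"
  shows "finite (singular_values M)"
proof (rule finite_subset)
  show "singular_values M \<subseteq> (\<lambda>k. sqrt (Re k)) ` spectrum (mat_adjoint M * M)"
  proof
    fix s assume "s \<in> singular_values M"
    then have "s = sqrt (Re (complex_of_real (s\<^sup>2)))"
      "complex_of_real (s\<^sup>2) \<in> spectrum (mat_adjoint M * M)"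
      unfolding singular_values_def spectrum_def by (auto simp flip: of_real_power)
    then show "s \<in> (\<lambda>k. sqrt (Re k)) ` spectrum (mat_adjoint M * M)" by blast
  qed
  show "finite ((\<lambda>k. sqrt (Re k)) ` spectrum (mat_adjoint M * M))"
    by (intro finite_imageI card_finite_spectrum(1)[of _ n] mult_carrier_mat[OF _ M])
      (simp add: M)
qed

lemma singular_value_le_sigma1:
  assumes "M \<in> carrier_mat m n" "s \<in> singular_values M"
  shows "s \<le> sigma1 M"
  unfolding sigma1_def using finite_singular_values[OF assms(1)] assms(2) by (rule Max_ge)

lemma sigma1_attained:
  assumes M: "M \<in> carrier_mat m n" and n: "1 \<le> n"
  shows "sigma1 M \<in> singular_values M"
proof -
  obtain \<mu> where "0 \<le> \<mu>" "eigenvalue (mat_adjoint M * M) (complex_of_real \<mu>)"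
    using ex_largest_eigenvalue[OF M n] by metis
  then have "sqrt \<mu> \<in> singular_values M" by (rule sqrt_in_singular_values)
  then show ?thesis
    unfolding sigma1_def using finite_singular_values[OF M] Max_in by blast
qed

lemma sigma1_nonneg:
  assumes "M \<in> carrier_mat m n" "1 \<le> n"
  shows "0 \<le> sigma1 M"
  using sigma1_attained[OF assms] unfolding singular_values_def by simp

lemma sigma1_eigenvector:
  assumes M: "M \<in> carrier_mat m n" and n: "1 \<le> n"
  obtains x where "x \<in> carrier_vec n" "x \<noteq> 0\<^sub>v n"
    "(mat_adjoint M * M) *\<^sub>v x = complex_of_real ((sigma1 M)\<^sup>2) \<cdot>\<^sub>v x"
proof -
  obtain x where "eigenvector (mat_adjoint M * M) x (complex_of_real ((sigma1 M)\<^sup>2))"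
    using sigma1_attained[OF M n] unfolding singular_values_def eigenvalue_def by blast
  with M that[of x] show thesis unfolding eigenvector_def by simp
qed

lemma sqnorm_mult_le_sigma1:
  assumes M: "M \<in> carrier_mat m n" and n: "1 \<le> n" and x: "x \<in> carrier_vec n"
  shows "sqnorm (M *\<^sub>v x) \<le> (sigma1 M)\<^sup>2 * sqnorm x"
proof -
  obtain \<mu> where mu: "0 \<le> \<mu>" "eigenvalue (mat_adjoint M * M) (complex_of_real \<mu>)"
    and bound: "\<And>x. x \<in> carrier_vec n \<Longrightarrow> sqnorm (M *\<^sub>v x) \<le> \<mu> * sqnorm x"
    using ex_largest_eigenvalue[OF M n] by metis
  have "sqrt \<mu> \<le> sigma1 M"
    by (rule singular_value_le_sigma1[OF M sqrt_in_singular_values[OF mu]])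
  then have "\<mu> \<le> (sigma1 M)\<^sup>2" by (rule sqrt_le_D)
  then show ?thesis
    using bound[OF x] sqnorm_nonneg[of x] by (meson mult_right_mono order_trans)
qed

text \<open>
  If \<open>x\<close> attains the bound then the right-hand side of \<open>sqnorm_defect_le\<close> vanishes, and with it the
  residual \<open>\<sigma>\<^sub>1(M)\<^sup>2 x - M\<^sup>* M x\<close>.
\<close>

lemma sigma1_maximiser_is_eigenvector:
  assumes M: "M \<in> carrier_mat m n" and n: "1 \<le> n" and x: "x \<in> carrier_vec n"
    and max: "(sigma1 M)\<^sup>2 * sqnorm x \<le> sqnorm (M *\<^sub>v x)"
  shows "(mat_adjoint M * M) *\<^sub>v x = complex_of_real ((sigma1 M)\<^sup>2) \<cdot>\<^sub>v x"
proof -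
  let ?y = "complex_of_real ((sigma1 M)\<^sup>2) \<cdot>\<^sub>v x" and ?z = "(mat_adjoint M * M) *\<^sub>v x"
  have c: "?z \<in> carrier_vec n" "?y \<in> carrier_vec n" using mult_carrier_mat[OF mat_adjoint_carrier[OF M] M] x by auto
  have "sqnorm (?y - ?z)
      \<le> ((sigma1 M)\<^sup>2 + 1) * ((sigma1 M)\<^sup>2 * sqnorm x - sqnorm (M *\<^sub>v x))"
    using sqnorm_mult_le_sigma1[OF M n] x by (intro sqnorm_defect_le[OF M]) auto
  also have "\<dots> \<le> 0" using max by (intro mult_nonneg_nonpos) auto
  finally have "sqnorm (?y - ?z) = 0" using sqnorm_nonneg[of "?y - ?z"] by linarith
  moreover have "dim_vec (?y - ?z) = n" using M by simp
  ultimately have diff: "?y - ?z = 0\<^sub>v n" using sqnorm_eq_0[of "?y - ?z"] by simp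
  show ?thesis
  proof (rule eq_vecI)
    show "dim_vec ?z = dim_vec ?y" using M x by simp
    fix i assume "i < dim_vec ?y"
    then have "i < n" using c by simp
    then have "(?y - ?z) $ i = 0" using diff by simp
    then show "?z $ i = ?y $ i" using M x \<open>i < n\<close> by simp
  qed
qed

section \<open>Perron vectors of nonnegative matrices\<close>

lemma sqnorm_map_cmod: "sqnorm (map_vec (\<lambda>c. complex_of_real (cmod c)) x) = sqnorm x"
  unfolding sqnorm_def by simp

lemma sqnorm_mult_le_map_cmod:
  assumes A: "A \<in> carrier_mat m n" and nonneg: "nonneg_complex_mat A" and x: "x \<in> carrier_vec n"
  shows "sqnorm (A *\<^sub>v x) \<le> sqnorm (A *\<^sub>v map_vec (\<lambda>c. complex_of_real (cmod c)) x)"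
proof -
  let ?z = "map_vec (\<lambda>c. complex_of_real (cmod c)) x"
  have "cmod ((A *\<^sub>v x) $ i) \<le> cmod ((A *\<^sub>v ?z) $ i)" if i: "i < m" for i
  proof -
    have a: "A $$ (i, j) = complex_of_real (cmod (A $$ (i, j)))" if "j < n" for j
    proof -
      have "A $$ (i, j) \<in> \<real>\<^sub>\<ge>\<^sub>0"
        using nonneg A i that unfolding nonneg_complex_mat_def by auto
      then show ?thesis by (auto elim: nonneg_Reals_cases)
    qed
    have "cmod ((A *\<^sub>v x) $ i) \<le> (\<Sum>j = 0..<n. cmod (A $$ (i, j)) * cmod (x $ j))"
      using A x i by (auto simp: scalar_prod_def norm_mult intro: order_trans[OF norm_sum])
    also have "\<dots> = cmod (complex_of_real (\<Sum>j = 0..<n. cmod (A $$ (i, j)) * cmod (x $ j)))"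
      by (simp only: norm_of_real) (simp add: sum_nonneg)
    also have "complex_of_real (\<Sum>j = 0..<n. cmod (A $$ (i, j)) * cmod (x $ j)) =
        (\<Sum>j = 0..<n. A $$ (i, j) * complex_of_real (cmod (x $ j)))"
      unfolding of_real_sum of_real_mult by (intro sum.cong) (simp_all flip: a)
    also have "\<dots> = (A *\<^sub>v ?z) $ i"
      using A x i by (auto simp: scalar_prod_def)
    finally show ?thesis .
  qed
  then have "(\<Sum>i = 0..<m. (cmod ((A *\<^sub>v x) $ i))\<^sup>2) \<le> (\<Sum>i = 0..<m. (cmod ((A *\<^sub>v ?z) $ i))\<^sup>2)"
    by (intro sum_mono power_mono) auto
  then show ?thesis unfolding sqnorm_def using A by simp
qed

text \<open>
  The weak form of the Perron-Frobenius theorem. Replacing the entries of a top eigenvector by their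
  moduli keeps its norm and, by the triangle inequality, does not shrink its image under \<open>A\<close>; the new
  vector therefore also attains \<open>\<sigma>\<^sub>1(A)\<close> and is an eigenvector again.
\<close>

lemma nonneg_sigma1_eigenvector:
  assumes A: "A \<in> carrier_mat m n" and n: "1 \<le> n" and nonneg: "nonneg_complex_mat A"
  obtains r where "\<And>j. 0 \<le> r j" "\<exists>j<n. r j \<noteq> 0"
    "(mat_adjoint A * A) *\<^sub>v vec n (\<lambda>j. complex_of_real (r j)) =
      complex_of_real ((sigma1 A)\<^sup>2) \<cdot>\<^sub>v vec n (\<lambda>j. complex_of_real (r j))"
proof -
  obtain x where x: "x \<in> carrier_vec n" "x \<noteq> 0\<^sub>v n"
    and ev: "(mat_adjoint A * A) *\<^sub>v x = complex_of_real ((sigma1 A)\<^sup>2) \<cdot>\<^sub>v x"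
    using sigma1_eigenvector[OF A n] by metis
  let ?z = "map_vec (\<lambda>c. complex_of_real (cmod c)) x"
  have z: "?z = vec n (\<lambda>j. complex_of_real (cmod (x $ j)))" using x by auto
  have "(sigma1 A)\<^sup>2 * sqnorm ?z = sqnorm (A *\<^sub>v x)"
    using sqnorm_mult_eigenvector[OF A x(1) ev] by (simp add: sqnorm_map_cmod)
  then have "(mat_adjoint A * A) *\<^sub>v ?z = complex_of_real ((sigma1 A)\<^sup>2) \<cdot>\<^sub>v ?z"
    using sqnorm_mult_le_map_cmod[OF A nonneg x(1)] x(1)
    by (intro sigma1_maximiser_is_eigenvector[OF A n]) auto
  moreover have "\<exists>j<n. cmod (x $ j) \<noteq> 0"
  proof (rule ccontr)
    assume "\<not> ?thesis"
    then have "x = 0\<^sub>v n" using x(1) by (intro eq_vecI) auto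
    with x(2) show False by simp
  qed
  ultimately show thesis using that[of "\<lambda>j. cmod (x $ j)"] unfolding z by simp
qed

section \<open>Partition matrices\<close>

definition part_mat :: "nat \<Rightarrow> nat set list \<Rightarrow> complex mat" where
  "part_mat N Ps = mat N (length Ps) (\<lambda>(i, p).
     if i \<in> Ps ! p then complex_of_real (1 / sqrt (real (card (Ps ! p)))) else 0)"

lemma part_mat_carrier [simp]: "part_mat N Ps \<in> carrier_mat N (length Ps)"
  unfolding part_mat_def by simp

lemma part_mat_dim [simp]:
  "dim_row (part_mat N Ps) = N" "dim_col (part_mat N Ps) = length Ps"
  unfolding part_mat_def by simp_all

context
  fixes N :: nat and Ps :: "nat set list"
  assumes P: "enum_partition {0..<N} Ps"
begin

lemma part_subset: "p < length Ps \<Longrightarrow> Ps ! p \<subseteq> {0..<N}"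
  using P unfolding enum_partition_def partition_on_def by (metis Union_upper nth_mem)

lemma part_finite: "p < length Ps \<Longrightarrow> finite (Ps ! p)"
  using part_subset finite_subset by blast

lemma part_card_pos: "p < length Ps \<Longrightarrow> 0 < card (Ps ! p)"
  using P part_finite unfolding enum_partition_def partition_on_def
  by (metis card_gt_0_iff nth_mem)

lemma part_weight:
  assumes "p < length Ps"
  shows "complex_of_real (1 / sqrt (real (card (Ps ! p)))) *
    complex_of_real (1 / sqrt (real (card (Ps ! p)))) * of_nat (card (Ps ! p)) = 1"
proof -
  have "1 / sqrt (real (card (Ps ! p))) * (1 / sqrt (real (card (Ps ! p)))) *
      real (card (Ps ! p)) = 1"
    using part_card_pos[OF assms] by simp
  then show ?thesis by (metis of_real_1 of_real_mult of_real_of_nat_eq)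
qed

lemma part_unique:
  assumes "p < length Ps" "q < length Ps" "i \<in> Ps ! p" "i \<in> Ps ! q"
  shows "p = q"
proof (rule ccontr)
  assume "p \<noteq> q"
  then have "Ps ! p \<noteq> Ps ! q"
    using assms P unfolding enum_partition_def by (simp add: nth_eq_iff_index_eq)
  then have "Ps ! p \<inter> Ps ! q = {}"
    using assms P unfolding enum_partition_def partition_on_def disjoint_def by simp
  with assms show False by auto
qed

lemma part_exists:
  assumes "i < N"
  obtains p where "p < length Ps" "i \<in> Ps ! p"
proof -
  have "i \<in> \<Union> (set Ps)"
    using P assms unfolding enum_partition_def partition_on_def by auto
  then show thesis using that by (auto simp: in_set_conv_nth)
qed

lemma mult_part_mat_index:
  assumes "A \<in> carrier_mat m N" "i < m" "q < length Ps"
  shows "(A * part_mat N Ps) $$ (i, q) =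
    complex_of_real (1 / sqrt (real (card (Ps ! q)))) * (\<Sum>j\<in>Ps ! q. A $$ (i, j))"
proof -
  let ?c = "complex_of_real (1 / sqrt (real (card (Ps ! q))))"
  have "(A * part_mat N Ps) $$ (i, q) = (\<Sum>j = 0..<N. A $$ (i, j) * (if j \<in> Ps ! q then ?c else 0))"
    using assms by (simp add: scalar_prod_def part_mat_def)
  also have "\<dots> = (\<Sum>j = 0..<N. if j \<in> Ps ! q then ?c * A $$ (i, j) else 0)"
    by (intro sum.cong) auto
  also have "\<dots> = (\<Sum>j\<in>{0..<N} \<inter> Ps ! q. ?c * A $$ (i, j))"
    by (rule sum.inter_restrict[symmetric]) simp
  also have "{0..<N} \<inter> Ps ! q = Ps ! q" using part_subset assms(3) by auto
  finally show ?thesis by (simp add: sum_distrib_left)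
qed

lemma adjoint_part_mat_mult_vec_index:
  assumes v: "v \<in> carrier_vec N" and p: "p < length Ps"
  shows "(mat_adjoint (part_mat N Ps) *\<^sub>v v) $ p =
    complex_of_real (1 / sqrt (real (card (Ps ! p)))) * (\<Sum>i\<in>Ps ! p. v $ i)"
proof -
  let ?c = "complex_of_real (1 / sqrt (real (card (Ps ! p))))"
  have "(mat_adjoint (part_mat N Ps) *\<^sub>v v) $ p =
      (\<Sum>i = 0..<N. (if i \<in> Ps ! p then ?c * v $ i else 0))"
    using v p by (auto simp: scalar_prod_def part_mat_def intro!: sum.cong)
  also have "\<dots> = (\<Sum>i\<in>{0..<N} \<inter> Ps ! p. ?c * v $ i)"
    by (rule sum.inter_restrict[symmetric]) simp
  also have "{0..<N} \<inter> Ps ! p = Ps ! p" using part_subset p by auto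
  finally show ?thesis by (simp add: sum_distrib_left)
qed

lemma part_mat_mult_vec_index:
  assumes y: "y \<in> carrier_vec (length Ps)" and p: "p < length Ps" "i \<in> Ps ! p"
  shows "(part_mat N Ps *\<^sub>v y) $ i = complex_of_real (1 / sqrt (real (card (Ps ! p)))) * y $ p"
proof -
  let ?c = "complex_of_real (1 / sqrt (real (card (Ps ! p))))"
  have i: "i < N" using part_subset[OF p(1)] p(2) by auto
  have mem: "i \<in> Ps ! q \<longleftrightarrow> q = p" if "q < length Ps" for q
    using part_unique[OF that p(1) _ p(2)] p(2) by blast
  have "(part_mat N Ps *\<^sub>v y) $ i = (\<Sum>q = 0..<length Ps.
      (if i \<in> Ps ! q then complex_of_real (1 / sqrt (real (card (Ps ! q)))) else 0) * y $ q)"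
    using y i by (simp add: scalar_prod_def part_mat_def)
  also have "\<dots> = (\<Sum>q = 0..<length Ps. if q = p then ?c * y $ p else 0)"
    by (intro sum.cong refl) (simp add: mem)
  finally show ?thesis using p(1) by simp
qed

lemma part_mat_orthonormal:
  assumes y: "y \<in> carrier_vec (length Ps)"
  shows "mat_adjoint (part_mat N Ps) *\<^sub>v (part_mat N Ps *\<^sub>v y) = y"
proof (rule eq_vecI)
  show "dim_vec (mat_adjoint (part_mat N Ps) *\<^sub>v (part_mat N Ps *\<^sub>v y)) = dim_vec y"
    using y by simp
  fix p assume "p < dim_vec y"
  then have p: "p < length Ps" using y by simp
  let ?c = "complex_of_real (1 / sqrt (real (card (Ps ! p))))"
  have W: "part_mat N Ps *\<^sub>v y \<in> carrier_vec N" by (intro carrier_vecI) simp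
  have "(mat_adjoint (part_mat N Ps) *\<^sub>v (part_mat N Ps *\<^sub>v y)) $ p =
      ?c * (\<Sum>i\<in>Ps ! p. ?c * y $ p)"
    unfolding adjoint_part_mat_mult_vec_index[OF W p]
    using part_mat_mult_vec_index[OF y p] by simp
  also have "\<dots> = (?c * ?c * of_nat (card (Ps ! p))) * y $ p" by simp
  also have "?c * ?c * of_nat (card (Ps ! p)) = 1"
    by (rule part_weight[OF p])
  finally show "(mat_adjoint (part_mat N Ps) *\<^sub>v (part_mat N Ps *\<^sub>v y)) $ p = y $ p"
    by simp
qed

lemma sqnorm_part_mat_mult:
  assumes y: "y \<in> carrier_vec (length Ps)"
  shows "sqnorm (part_mat N Ps *\<^sub>v y) = sqnorm y"
proof -
  have "part_mat N Ps *\<^sub>v y \<in> carrier_vec N" by (intro carrier_vecI) simp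
  then have "(part_mat N Ps *\<^sub>v y) \<bullet>c (part_mat N Ps *\<^sub>v y) = y \<bullet>c y"
    using cscalar_mult_mat_left[OF part_mat_carrier y] part_mat_orthonormal[OF y] by metis
  then show ?thesis by (simp add: sqnorm_cscalar)
qed

text \<open>
  Bessel's inequality: with \<open>u = W\<^sup>* v\<close>, the vector \<open>W u\<close> is the orthogonal projection of \<open>v\<close> onto the
  span of the indicators, and \<open>|v - W u|\<^sup>2 = |v|\<^sup>2 - |u|\<^sup>2\<close>.
\<close>

lemma sqnorm_adjoint_part_mat_mult_le:
  assumes v: "v \<in> carrier_vec N"
  shows "sqnorm (mat_adjoint (part_mat N Ps) *\<^sub>v v) \<le> sqnorm v"
proof -
  let ?u = "mat_adjoint (part_mat N Ps) *\<^sub>v v"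
  let ?w = "part_mat N Ps *\<^sub>v ?u"
  have u: "?u \<in> carrier_vec (length Ps)"
    by (rule mat_adjoint_mult_vec_carrier[OF part_mat_carrier])
  have w: "?w \<in> carrier_vec N" by (intro carrier_vecI) simp
  have "v \<bullet>c ?w = ?u \<bullet>c ?u"
    using cscalar_mult_mat_right[OF part_mat_carrier u v] .
  then have "Re (v \<bullet>c ?w) = sqnorm ?u" by (simp add: sqnorm_cscalar)
  then have "sqnorm (v - complex_of_real 1 \<cdot>\<^sub>v ?w) = sqnorm v - sqnorm ?u"
    unfolding sqnorm_minus_smult[OF v w] by (simp add: sqnorm_part_mat_mult[OF u])
  then show ?thesis using sqnorm_nonneg[of "v - complex_of_real 1 \<cdot>\<^sub>v ?w"] by linarith
qed

text \<open>
  Summing nonnegative entries over a part leaves no room for cancellation, so the part that contains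
  a nonzero entry contributes a nonzero coordinate.
\<close>

lemma adjoint_part_mat_mult_nonneg_ne_0:
  assumes r: "\<And>i. 0 \<le> r i" "\<exists>i<N. r i \<noteq> 0"
  shows "mat_adjoint (part_mat N Ps) *\<^sub>v vec N (\<lambda>i. complex_of_real (r i)) \<noteq> 0\<^sub>v (length Ps)"
proof
  let ?z = "vec N (\<lambda>i. complex_of_real (r i))"
  assume zero: "mat_adjoint (part_mat N Ps) *\<^sub>v ?z = 0\<^sub>v (length Ps)"
  obtain i where i: "i < N" "r i \<noteq> 0" using r(2) by auto
  obtain p where p: "p < length Ps" "i \<in> Ps ! p" using part_exists[OF i(1)] .
  have "(\<Sum>k\<in>Ps ! p. ?z $ k) = complex_of_real (\<Sum>k\<in>Ps ! p. r k)"
    unfolding of_real_sum using part_subset[OF p(1)] by (intro sum.cong) auto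
  then have "complex_of_real (1 / sqrt (real (card (Ps ! p))) * (\<Sum>k\<in>Ps ! p. r k)) = 0"
    using adjoint_part_mat_mult_vec_index[OF _ p(1), of ?z] p(1) unfolding zero by simp
  then have "(\<Sum>k\<in>Ps ! p. r k) = 0"
    using part_card_pos[OF p(1)] unfolding of_real_eq_0_iff by simp
  then show False
    using r(1) i(2) p(2) part_finite[OF p(1)] by (simp add: sum_nonneg_eq_0_iff)
qed

end

section \<open>Quotient matrices\<close>

lemma quotient_mat_carrier [simp]:
  "quotient_mat A Ps Qs \<in> carrier_mat (length Ps) (length Qs)"
  unfolding quotient_mat_def by simp

lemma quotient_mat_index:
  assumes "p < length Ps" "q < length Qs"
  shows "quotient_mat A Ps Qs $$ (p, q) =
    complex_of_real (1 / sqrt (real (card (Ps ! p)))) *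
    (complex_of_real (1 / sqrt (real (card (Qs ! q)))) * (\<Sum>i\<in>Ps ! p. \<Sum>j\<in>Qs ! q. A $$ (i, j)))"
  unfolding quotient_mat_def using assms by (simp add: real_sqrt_mult)

text \<open>
  This is the factorisation \<open>B = U\<^sup>* A V\<close> of the quotient matrix, applied to a vector.
\<close>

lemma quotient_mat_mult_vec:
  assumes A: "A \<in> carrier_mat m n" and P: "enum_partition {0..<m} Ps"
    and Q: "enum_partition {0..<n} Qs" and y: "y \<in> carrier_vec (length Qs)"
  shows "quotient_mat A Ps Qs *\<^sub>v y =
    mat_adjoint (part_mat m Ps) *\<^sub>v (A *\<^sub>v (part_mat n Qs *\<^sub>v y))"
proof -
  have AW: "A * part_mat n Qs \<in> carrier_mat m (length Qs)"
    by (rule mult_carrier_mat[OF A]) simp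
  have "quotient_mat A Ps Qs = mat_adjoint (part_mat m Ps) * (A * part_mat n Qs)" (is "?B = ?C")
  proof (rule eq_matI)
    fix p q assume "p < dim_row ?C" "q < dim_col ?C"
    then have p: "p < length Ps" and q: "q < length Qs" by auto
    have "?C $$ (p, q) = (mat_adjoint (part_mat m Ps) *\<^sub>v col (A * part_mat n Qs) q) $ p"
      using p q by simp
    also have "\<dots> = complex_of_real (1 / sqrt (real (card (Ps ! p)))) *
        (\<Sum>i\<in>Ps ! p. col (A * part_mat n Qs) q $ i)"
      using A by (intro adjoint_part_mat_mult_vec_index[OF P _ p] carrier_vecI) simp
    also have "(\<Sum>i\<in>Ps ! p. col (A * part_mat n Qs) q $ i) =
        (\<Sum>i\<in>Ps ! p. complex_of_real (1 / sqrt (real (card (Qs ! q)))) * (\<Sum>j\<in>Qs ! q. A $$ (i, j)))"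
    proof (rule sum.cong[OF refl])
      fix i assume "i \<in> Ps ! p"
      then have i: "i < m" using part_subset[OF P p] by auto
      then have "col (A * part_mat n Qs) q $ i = (A * part_mat n Qs) $$ (i, q)"
        using A q by simp
      then show "col (A * part_mat n Qs) q $ i =
          complex_of_real (1 / sqrt (real (card (Qs ! q)))) * (\<Sum>j\<in>Qs ! q. A $$ (i, j))"
        using mult_part_mat_index[OF Q A i q] by simp
    qed
    finally show "?B $$ (p, q) = ?C $$ (p, q)"
      unfolding quotient_mat_index[OF p q] by (simp add: sum_distrib_left)
  qed (simp_all add: quotient_mat_def)
  then show ?thesis
    using y assoc_mult_mat_vec[OF mat_adjoint_carrier[OF part_mat_carrier] AW y]
      assoc_mult_mat_vec[OF A part_mat_carrier y] by simp
qed

lemma quotient_mat_adjoint: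
  assumes A: "A \<in> carrier_mat m n" and P: "enum_partition {0..<m} Ps"
    and Q: "enum_partition {0..<n} Qs"
  shows "quotient_mat (mat_adjoint A) Qs Ps = mat_adjoint (quotient_mat A Ps Qs)"
proof (rule eq_matI)
  fix q p assume "q < dim_row (mat_adjoint (quotient_mat A Ps Qs))"
    "p < dim_col (mat_adjoint (quotient_mat A Ps Qs))"
  then have p: "p < length Ps" and q: "q < length Qs" by (auto simp: quotient_mat_def)
  have "(\<Sum>j\<in>Qs ! q. \<Sum>i\<in>Ps ! p. mat_adjoint A $$ (j, i)) =
      (\<Sum>j\<in>Qs ! q. \<Sum>i\<in>Ps ! p. cnj (A $$ (i, j)))"
  proof (intro sum.cong[OF refl])
    fix i j assume "j \<in> Qs ! q" "i \<in> Ps ! p"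
    then have "j < n" "i < m" using part_subset[OF P p] part_subset[OF Q q] by auto
    then show "mat_adjoint A $$ (j, i) = cnj (A $$ (i, j))" using A by simp
  qed
  also have "\<dots> = cnj (\<Sum>i\<in>Ps ! p. \<Sum>j\<in>Qs ! q. A $$ (i, j))"
    unfolding cnj_sum by (rule sum.swap)
  finally show "quotient_mat (mat_adjoint A) Qs Ps $$ (q, p) =
      mat_adjoint (quotient_mat A Ps Qs) $$ (q, p)"
    using p q by (simp add: quotient_mat_def mult.commute)
qed (simp_all add: quotient_mat_def)

text \<open>
  Evaluate at a top eigenvector \<open>y\<close> of \<open>B\<^sup>* B\<close>:
  \<open>\<sigma>\<^sub>1(B) |y| = |U\<^sup>* A V y| \<le> |A V y| \<le> \<sigma>\<^sub>1(A) |V y| = \<sigma>\<^sub>1(A) |y|\<close>.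
\<close>

lemma sigma1_quotient_mat_le:
  assumes A: "A \<in> carrier_mat m n" and n: "1 \<le> n"
    and P: "enum_partition {0..<m} Ps" and Q: "enum_partition {0..<n} Qs"
  shows "sigma1 (quotient_mat A Ps Qs) \<le> sigma1 A"
proof -
  let ?B = "quotient_mat A Ps Qs"
  obtain q where "q < length Qs" using part_exists[OF Q, of 0] n by auto
  then have l: "1 \<le> length Qs" by simp
  obtain y where y: "y \<in> carrier_vec (length Qs)" "y \<noteq> 0\<^sub>v (length Qs)"
    and ev: "(mat_adjoint ?B * ?B) *\<^sub>v y = complex_of_real ((sigma1 ?B)\<^sup>2) \<cdot>\<^sub>v y"
    using sigma1_eigenvector[OF quotient_mat_carrier l] by metis
  have Wy: "part_mat n Qs *\<^sub>v y \<in> carrier_vec n" by (intro carrier_vecI) simp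
  have AWy: "A *\<^sub>v (part_mat n Qs *\<^sub>v y) \<in> carrier_vec m" using A by (intro carrier_vecI) simp
  have "(sigma1 ?B)\<^sup>2 * sqnorm y = sqnorm (?B *\<^sub>v y)"
    by (rule sqnorm_mult_eigenvector[OF quotient_mat_carrier y(1) ev, symmetric])
  also have "\<dots> \<le> sqnorm (A *\<^sub>v (part_mat n Qs *\<^sub>v y))"
    unfolding quotient_mat_mult_vec[OF A P Q y(1)]
    by (rule sqnorm_adjoint_part_mat_mult_le[OF P AWy])
  also have "\<dots> \<le> (sigma1 A)\<^sup>2 * sqnorm (part_mat n Qs *\<^sub>v y)"
    by (rule sqnorm_mult_le_sigma1[OF A n Wy])
  also have "\<dots> = (sigma1 A)\<^sup>2 * sqnorm y"
    by (simp add: sqnorm_part_mat_mult[OF Q y(1)])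
  finally have "(sigma1 ?B)\<^sup>2 * sqnorm y \<le> (sigma1 A)\<^sup>2 * sqnorm y" .
  moreover have "0 < sqnorm y" using sqnorm_eq_0[of y] sqnorm_nonneg[of y] y by auto
  ultimately have "(sigma1 ?B)\<^sup>2 \<le> (sigma1 A)\<^sup>2" by simp
  then show ?thesis using sigma1_nonneg[OF A n] by (rule power2_le_imp_le)
qed

section \<open>Equitable partitions\<close>

lemma bij_betw_pick:
  assumes "finite S"
  shows "bij_betw (pick S) {..<card S} S"
proof -
  have inj: "inj_on (pick S) {..<card S}"
  proof (rule linorder_inj_onI')
    fix a b assume "b \<in> {..<card S}" "a < b"
    then have "pick S a < pick S b" by (intro pick_mono_le) (rule iffD1[OF lessThan_iff])
    then show "pick S a \<noteq> pick S b" by (rule less_imp_neq)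
  qed
  moreover have "pick S ` {..<card S} = S"
  proof (rule card_subset_eq[OF assms])
    show "pick S ` {..<card S} \<subseteq> S"
      by (rule image_subsetI) (rule pick_in_set_le, rule iffD1[OF lessThan_iff])
    show "card (pick S ` {..<card S}) = card S" unfolding card_image[OF inj] by (rule card_lessThan)
  qed
  ultimately show ?thesis unfolding bij_betw_def ..
qed

text \<open>
  Submatrices are indexed through the enumeration \<open>pick\<close>; this transfers regularity back to sums over
  the index sets themselves.
\<close>

lemma regular_submatrix_sums:
  assumes A: "A \<in> carrier_mat m n" and I: "I \<subseteq> {0..<m}" and J: "J \<subseteq> {0..<n}"
    and reg: "regular_mat (submatrix A I J)"
  shows "\<lbrakk>i \<in> I; i' \<in> I\<rbrakk> \<Longrightarrow> (\<Sum>j\<in>J. A $$ (i, j)) = (\<Sum>j\<in>J. A $$ (i', j))"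
    and "\<lbrakk>j \<in> J; j' \<in> J\<rbrakk> \<Longrightarrow> (\<Sum>i\<in>I. A $$ (i, j)) = (\<Sum>i\<in>I. A $$ (i, j'))"
proof -
  have fin: "finite I" "finite J" using I J finite_subset by blast+
  have sets: "{i. i < dim_row A \<and> i \<in> I} = I" "{j. j < dim_col A \<and> j \<in> J} = J"
    using A I J by auto
  have dims: "dim_row (submatrix A I J) = card I" "dim_col (submatrix A I J) = card J"
    unfolding dim_submatrix sets by simp_all
  have index: "submatrix A I J $$ (a, b) = A $$ (pick I a, pick J b)"
    if "a < card I" "b < card J" for a b
    using submatrix_index[of a A I b J] that unfolding sets by simp
  have onto: "\<exists>a<card S. pick S a = i" if "finite S" "i \<in> S" for S i
  proof -
    have "i \<in> pick S ` {..<card S}"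
      using bij_betw_imp_surj_on[OF bij_betw_pick[OF that(1)]] that(2) by blast
    then show ?thesis by blast
  qed
  have row: "(\<Sum>b<card J. submatrix A I J $$ (a, b)) = (\<Sum>j\<in>J. A $$ (pick I a, j))"
    if "a < card I" for a
    using sum.reindex_bij_betw[OF bij_betw_pick[OF fin(2)], of "\<lambda>j. A $$ (pick I a, j)"] index that
    by simp
  have col: "(\<Sum>a<card I. submatrix A I J $$ (a, b)) = (\<Sum>i\<in>I. A $$ (i, pick J b))"
    if "b < card J" for b
    using sum.reindex_bij_betw[OF bij_betw_pick[OF fin(1)], of "\<lambda>i. A $$ (i, pick J b)"] index that
    by simp
  show "(\<Sum>j\<in>J. A $$ (i, j)) = (\<Sum>j\<in>J. A $$ (i', j))" if i: "i \<in> I" "i' \<in> I"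
  proof -
    obtain a where a: "a < card I" "pick I a = i" using onto[OF fin(1) i(1)] by blast
    obtain a' where a': "a' < card I" "pick I a' = i'" using onto[OF fin(1) i(2)] by blast
    have "(\<Sum>b<card J. submatrix A I J $$ (a, b)) = (\<Sum>b<card J. submatrix A I J $$ (a', b))"
      using reg a(1) a'(1) unfolding regular_mat_def dims by blast
    then show ?thesis unfolding row[OF a(1)] row[OF a'(1)] a(2) a'(2) .
  qed
  show "(\<Sum>i\<in>I. A $$ (i, j)) = (\<Sum>i\<in>I. A $$ (i, j'))" if j: "j \<in> J" "j' \<in> J"
  proof -
    obtain b where b: "b < card J" "pick J b = j" using onto[OF fin(2) j(1)] by blast
    obtain b' where b': "b' < card J" "pick J b' = j'" using onto[OF fin(2) j(2)] by blast
    have "(\<Sum>a<card I. submatrix A I J $$ (a, b)) = (\<Sum>a<card I. submatrix A I J $$ (a, b'))"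
      using reg b(1) b'(1) unfolding regular_mat_def dims by blast
    then show ?thesis unfolding col[OF b(1)] col[OF b'(1)] b(2) b'(2) .
  qed
qed

text \<open>
  In row \<open>i\<close> of part \<open>P\<close> and column \<open>Q\<close>, both sides equal the sum of row \<open>i\<close> over \<open>Q\<close> divided by
  \<open>sqrt |Q|\<close>: on the right, the block has \<open>|P|\<close> rows with this same sum, and the two factors
  \<open>1 / sqrt |P|\<close> cancel against \<open>|P|\<close>.
\<close>

lemma constant_row_sums_intertwine:
  assumes A: "A \<in> carrier_mat m n" and P: "enum_partition {0..<m} Ps"
    and Q: "enum_partition {0..<n} Qs"
    and const: "\<And>p q i i'. \<lbrakk>p < length Ps; q < length Qs; i \<in> Ps ! p; i' \<in> Ps ! p\<rbrakk>
      \<Longrightarrow> (\<Sum>j\<in>Qs ! q. A $$ (i, j)) = (\<Sum>j\<in>Qs ! q. A $$ (i', j))"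
  shows "A * part_mat n Qs = part_mat m Ps * quotient_mat A Ps Qs" (is "?L = ?R")
proof (rule eq_matI)
  fix i q assume "i < dim_row ?R" "q < dim_col ?R"
  then have i: "i < m" and q: "q < length Qs" by (auto simp: quotient_mat_def)
  obtain p where p: "p < length Ps" "i \<in> Ps ! p" using part_exists[OF P i] .
  let ?c = "complex_of_real (1 / sqrt (real (card (Ps ! p))))"
  let ?d = "complex_of_real (1 / sqrt (real (card (Qs ! q))))"
  let ?s = "\<Sum>j\<in>Qs ! q. A $$ (i, j)"
  have "?R $$ (i, q) = (part_mat m Ps *\<^sub>v col (quotient_mat A Ps Qs) q) $ i"
    using i q by (simp add: quotient_mat_def)
  also have "\<dots> = ?c * col (quotient_mat A Ps Qs) q $ p"
    by (intro part_mat_mult_vec_index[OF P _ p] carrier_vecI) (simp add: quotient_mat_def)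
  also have "col (quotient_mat A Ps Qs) q $ p = quotient_mat A Ps Qs $$ (p, q)"
    using p q by (simp add: quotient_mat_def)
  also have "\<dots> = ?c * (?d * (\<Sum>i'\<in>Ps ! p. ?s))"
    unfolding quotient_mat_index[OF p(1) q]
    by (intro arg_cong2[where f = "(*)"] refl sum.cong const[OF p(1) q _ p(2)])
  also have "?c * (?c * (?d * (\<Sum>i'\<in>Ps ! p. ?s))) = (?c * ?c * of_nat (card (Ps ! p))) * (?d * ?s)"
    by (simp only: sum_constant mult_ac)
  also have "?c * ?c * of_nat (card (Ps ! p)) = 1"
    by (rule part_weight[OF P p(1)])
  finally show "?L $$ (i, q) = ?R $$ (i, q)"
    using mult_part_mat_index[OF Q A i q] by simp
qed (use A in \<open>simp_all add: quotient_mat_def\<close>)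

text \<open>
  The second identity is the first one for \<open>A\<^sup>*\<close>, whose row sums are the conjugated column sums of \<open>A\<close>.
\<close>

lemma equitable_intertwine:
  assumes A: "A \<in> carrier_mat m n" and P: "enum_partition {0..<m} Ps"
    and Q: "enum_partition {0..<n} Qs" and eq: "equitable A Ps Qs"
  shows "A * part_mat n Qs = part_mat m Ps * quotient_mat A Ps Qs"
    and "mat_adjoint A * part_mat m Ps = part_mat n Qs * mat_adjoint (quotient_mat A Ps Qs)"
proof -
  have reg: "regular_mat (submatrix A (Ps ! p) (Qs ! q))" if "p < length Ps" "q < length Qs" for p q
    using eq that unfolding equitable_def by simp
  note sums = regular_submatrix_sums[OF A part_subset[OF P] part_subset[OF Q] reg]
  show "A * part_mat n Qs = part_mat m Ps * quotient_mat A Ps Qs"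
    by (rule constant_row_sums_intertwine[OF A P Q]) (rule sums(1))
  have "mat_adjoint A * part_mat m Ps = part_mat n Qs * quotient_mat (mat_adjoint A) Qs Ps"
  proof (rule constant_row_sums_intertwine[OF mat_adjoint_carrier[OF A] Q P])
    fix q p j j' assume q: "q < length Qs" and p: "p < length Ps"
      and j: "j \<in> Qs ! q" and j': "j' \<in> Qs ! q"
    have "(\<Sum>i\<in>Ps ! p. mat_adjoint A $$ (k, i)) = cnj (\<Sum>i\<in>Ps ! p. A $$ (i, k))"
      if "k \<in> Qs ! q" for k
      unfolding cnj_sum
    proof (rule sum.cong[OF refl])
      fix i assume "i \<in> Ps ! p"
      then have "i < m" "k < n" using that part_subset[OF P p] part_subset[OF Q q] by auto
      then show "mat_adjoint A $$ (k, i) = cnj (A $$ (i, k))" using A by simp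
    qed
    then show "(\<Sum>i\<in>Ps ! p. mat_adjoint A $$ (j, i)) = (\<Sum>i\<in>Ps ! p. mat_adjoint A $$ (j', i))"
      using sums(2)[OF p q p q j j'] j j' by presburger
  qed
  then show "mat_adjoint A * part_mat m Ps = part_mat n Qs * mat_adjoint (quotient_mat A Ps Qs)"
    unfolding quotient_mat_adjoint[OF A P Q] .
qed

text \<open>
  Adjoining the two intertwining relations gives \<open>V\<^sup>* A\<^sup>* = B\<^sup>* U\<^sup>*\<close> and \<open>U\<^sup>* A = B V\<^sup>*\<close>, which move
  \<open>V\<^sup>*\<close> past the two factors of \<open>B\<^sup>* B\<close> one at a time.
\<close>

lemma equitable_quotient_gram:
  assumes A: "A \<in> carrier_mat m n" and P: "enum_partition {0..<m} Ps"
    and Q: "enum_partition {0..<n} Qs" and eq: "equitable A Ps Qs"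
  shows "(mat_adjoint (quotient_mat A Ps Qs) * quotient_mat A Ps Qs) * mat_adjoint (part_mat n Qs) =
    mat_adjoint (part_mat n Qs) * (mat_adjoint A * A)"
proof -
  let ?B = "quotient_mat A Ps Qs" and ?U = "part_mat m Ps" and ?V = "part_mat n Qs"
  have B: "?B \<in> carrier_mat (length Ps) (length Qs)" and U: "?U \<in> carrier_mat m (length Ps)"
    and V: "?V \<in> carrier_mat n (length Qs)" by simp_all
  have A': "mat_adjoint A \<in> carrier_mat n m" and B': "mat_adjoint ?B \<in> carrier_mat (length Qs) (length Ps)"
    and U': "mat_adjoint ?U \<in> carrier_mat (length Ps) m"
    and V': "mat_adjoint ?V \<in> carrier_mat (length Qs) n" using A by simp_all
  have 1: "mat_adjoint ?V * mat_adjoint A = mat_adjoint ?B * mat_adjoint ?U"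
    using arg_cong[OF equitable_intertwine(1)[OF assms], of mat_adjoint]
    by (simp only: mat_adjoint_mult[OF A V] mat_adjoint_mult[OF U B])
  have 2: "mat_adjoint ?U * A = ?B * mat_adjoint ?V"
    using arg_cong[OF equitable_intertwine(2)[OF assms], of mat_adjoint]
    by (simp only: mat_adjoint_mult[OF A' U] mat_adjoint_mult[OF V B'] mat_adjoint_adjoint)
  have "(mat_adjoint ?B * ?B) * mat_adjoint ?V = mat_adjoint ?B * (?B * mat_adjoint ?V)"
    by (rule assoc_mult_mat[OF B' B V'])
  also have "\<dots> = (mat_adjoint ?B * mat_adjoint ?U) * A"
    unfolding 2[symmetric] by (rule assoc_mult_mat[OF B' U' A, symmetric])
  also have "\<dots> = mat_adjoint ?V * (mat_adjoint A * A)"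
    unfolding 1[symmetric] by (rule assoc_mult_mat[OF V' A' A])
  finally show ?thesis .
qed

text \<open>
  The nonnegative top eigenvector \<open>z\<close> of \<open>A\<^sup>* A\<close> descends to the eigenvector \<open>V\<^sup>* z\<close> of \<open>B\<^sup>* B\<close> for
  the same eigenvalue, so \<open>\<sigma>\<^sub>1(A)\<close> is one of the singular values of \<open>B\<close>.
\<close>

lemma sigma1_equitable_le:
  assumes A: "A \<in> carrier_mat m n" and n: "1 \<le> n"
    and P: "enum_partition {0..<m} Ps" and Q: "enum_partition {0..<n} Qs"
    and nonneg: "nonneg_complex_mat A" and eq: "equitable A Ps Qs"
  shows "sigma1 A \<le> sigma1 (quotient_mat A Ps Qs)"
proof -
  let ?B = "quotient_mat A Ps Qs" and ?V = "part_mat n Qs"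
  let ?s = "complex_of_real ((sigma1 A)\<^sup>2)"
  obtain r where r: "\<And>j. 0 \<le> r j" "\<exists>j<n. r j \<noteq> 0"
    and ev: "(mat_adjoint A * A) *\<^sub>v vec n (\<lambda>j. complex_of_real (r j)) =
      ?s \<cdot>\<^sub>v vec n (\<lambda>j. complex_of_real (r j))"
    using nonneg_sigma1_eigenvector[OF A n nonneg] by metis
  define z where "z = vec n (\<lambda>j. complex_of_real (r j))"
  define y where "y = mat_adjoint ?V *\<^sub>v z"
  have z: "z \<in> carrier_vec n" unfolding z_def by simp
  have V': "mat_adjoint ?V \<in> carrier_mat (length Qs) n" by simp
  have G: "mat_adjoint ?B * ?B \<in> carrier_mat (length Qs) (length Qs)"
    by (rule gram_carrier[OF quotient_mat_carrier])
  have "(mat_adjoint ?B * ?B) *\<^sub>v y = (mat_adjoint ?B * ?B * mat_adjoint ?V) *\<^sub>v z"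
    unfolding y_def by (rule assoc_mult_mat_vec[OF G V' z, symmetric])
  also have "\<dots> = mat_adjoint ?V *\<^sub>v ((mat_adjoint A * A) *\<^sub>v z)"
    unfolding equitable_quotient_gram[OF A P Q eq]
    by (rule assoc_mult_mat_vec[OF V' gram_carrier[OF A] z])
  also have "\<dots> = ?s \<cdot>\<^sub>v y"
    unfolding ev[folded z_def] y_def by (rule mult_mat_vec[OF V' z])
  finally have "(mat_adjoint ?B * ?B) *\<^sub>v y = ?s \<cdot>\<^sub>v y" .
  moreover have "y \<noteq> 0\<^sub>v (length Qs)"
    unfolding y_def z_def by (rule adjoint_part_mat_mult_nonneg_ne_0[OF Q r])
  moreover have "y \<in> carrier_vec (length Qs)"
    unfolding y_def by (rule mat_adjoint_mult_vec_carrier[OF part_mat_carrier])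
  ultimately have "eigenvalue (mat_adjoint ?B * ?B) ?s"
    unfolding eigenvalue_def eigenvector_def using G by (metis carrier_matD(1))
  then have "sigma1 A \<in> singular_values ?B"
    unfolding singular_values_def using sigma1_nonneg[OF A n] by simp
  then show ?thesis by (rule singular_value_le_sigma1[OF quotient_mat_carrier])
qed

theorem theorem7:
  fixes A :: "complex mat" and m n :: nat and Ps Qs :: "nat set list"
  assumes "m \<ge> 1" and "n \<ge> 1"
    and "A \<in> carrier_mat m n"
    and "enum_partition {0..<m} Ps"
    and "enum_partition {0..<n} Qs"
  shows "sigma1 A \<ge> sigma1 (quotient_mat A Ps Qs) \<and>
    (nonneg_complex_mat A \<and>
     irreducible_mat (A * mat_adjoint A) \<and> irreducible_mat (mat_adjoint A * A) \<and>
     equitable A Ps Qs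
     \<longrightarrow> sigma1 A = sigma1 (quotient_mat A Ps Qs))"
  using sigma1_quotient_mat_le[OF assms(3,2,4,5)] sigma1_equitable_le[OF assms(3,2,4,5)]
  by (auto intro: antisym)

end
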